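(* Let $l\le d/2$ and let $\mathbf{N}=(N_1,\dots,N_{l+1})$ be a POVM on $\mathbb{C}^d$ with $N_i=A_i\ket{\psi_i}\bra{\psi_i}$ for $i\in[l]$, where $\ket{\psi_i}$ are unit vectors and $A_i\ge0$. Let $W=\mathrm{span}_{\mathbb{C}}\{\ket{\psi_i}:i\in[l]\}$, $W^\perp$ its orthogonal complement with orthogonal projector $\mathbb{P}_{W^\perp}$, and $|W^\perp|$ its dimension. Define $F_i=A_i\ket{\psi_i}\bra{\psi_i}+\frac{1-A_i}{|W^\perp|}\mathbb{P}_{W^\perp}$ for $i\in[l]$ and $F_{l+1}=\mathbb{I}_d-\sum_{i=1}^lF_i$. Then $\mathbf{F}=(F_1,\dots,F_{l+1})$ is a POVM and $\mathbf{F}\in\mathrm{SP}(d)$.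
   Context: A POVM on $\mathbb{C}^d$ is a tuple of positive semidefinite operators summing to $\mathbb{I}_d$; projective if $M_iM_j=\delta_{ij}M_i$. A classical post-processing (numbers $q_{i|j}\ge0$, $\sum_iq_{i|j}=1$) maps effects $M_j$ to $\sum_jq_{i|j}M_j$. $\mathrm{SP}(d)$ is the set of finite effect-wise convex combinations of post-processed projective measurements on $\mathbb{C}^d$. *)

theory Defs
  imports "HOL-Analysis.Analysis"
begin

text \<open>Matrices on C^d are represented as complex^'n^'n with d = CARD('n).
  Measurements with m outcomes are functions nat => matrix, outcomes indexed by {1..m}.\<close>

definition cinner :: "complex^'n \<Rightarrow> complex^'n \<Rightarrow> complex" where
  "cinner u v = (\<Sum>i\<in>UNIV. cnj (u$i) * v$i)"

definition adjoint_mat :: "complex^'n^'n \<Rightarrow> complex^'n^'n" where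
  "adjoint_mat A = (\<chi> i j. cnj (A$j$i))"

definition psd :: "complex^'n^'n \<Rightarrow> bool" where
  "psd A \<longleftrightarrow> adjoint_mat A = A \<and> (\<forall>v. Im (cinner v (A *v v)) = 0 \<and> 0 \<le> Re (cinner v (A *v v)))"

definition outer :: "complex^'n \<Rightarrow> complex^'n^'n" where
  "outer u = (\<chi> i j. u$i * cnj (u$j))"

definition is_povm :: "nat \<Rightarrow> (nat \<Rightarrow> complex^'n^'n) \<Rightarrow> bool" where
  "is_povm m M \<longleftrightarrow> (\<forall>i\<in>{1..m}. psd (M i)) \<and> (\<Sum>i\<in>{1..m}. M i) = mat 1"

definition is_projective :: "nat \<Rightarrow> (nat \<Rightarrow> complex^'n^'n) \<Rightarrow> bool" where
  "is_projective m M \<longleftrightarrow> is_povm m M \<and>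
     (\<forall>i\<in>{1..m}. \<forall>j\<in>{1..m}. M i ** M j = (if i = j then M i else 0))"

definition is_postproc :: "nat \<Rightarrow> nat \<Rightarrow> (nat \<Rightarrow> nat \<Rightarrow> real) \<Rightarrow> bool" where
  "is_postproc m k q \<longleftrightarrow> (\<forall>i\<in>{1..m}. \<forall>j\<in>{1..k}. 0 \<le> q i j) \<and>
     (\<forall>j\<in>{1..k}. (\<Sum>i\<in>{1..m}. q i j) = 1)"

definition postproc :: "nat \<Rightarrow> (nat \<Rightarrow> nat \<Rightarrow> real) \<Rightarrow> (nat \<Rightarrow> complex^'n^'n) \<Rightarrow> nat \<Rightarrow> complex^'n^'n" where
  "postproc k q M i = (\<Sum>j\<in>{1..k}. q i j *\<^sub>R M j)"

definition in_SP :: "nat \<Rightarrow> (nat \<Rightarrow> complex^'n^'n) \<Rightarrow> bool" where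
  "in_SP m F \<longleftrightarrow> (\<exists>(R::nat) (p::nat \<Rightarrow> real) (k::nat \<Rightarrow> nat) (P::nat \<Rightarrow> nat \<Rightarrow> complex^'n^'n)
       (q::nat \<Rightarrow> nat \<Rightarrow> nat \<Rightarrow> real).
     (\<forall>r\<in>{1..R}. 0 \<le> p r) \<and> (\<Sum>r\<in>{1..R}. p r) = 1 \<and>
     (\<forall>r\<in>{1..R}. is_projective (k r) (P r) \<and> is_postproc m (k r) (q r)) \<and>
     (\<forall>i\<in>{1..m}. F i = (\<Sum>r\<in>{1..R}. p r *\<^sub>R postproc (k r) (q r) (P r) i)))"

definition cspan :: "(complex^'n) set \<Rightarrow> (complex^'n) set" where
  "cspan S = {v. \<exists>T c. finite T \<and> T \<subseteq> S \<and> v = (\<Sum>w\<in>T. c w *s w)}"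

definition corth :: "(complex^'n) set \<Rightarrow> (complex^'n) set" where
  "corth W = {v. \<forall>w\<in>W. cinner w v = 0}"

definition cdim :: "(complex^'n) set \<Rightarrow> nat" where
  "cdim U = (LEAST k. \<exists>T. finite T \<and> card T = k \<and> cspan T = U)"

definition orth_proj :: "(complex^'n) set \<Rightarrow> complex^'n^'n" where
  "orth_proj U = (THE P. adjoint_mat P = P \<and> P ** P = P \<and> range (\<lambda>v. P *v v) = U)"

end

theory Submission
  imports Defs
begin

text \<open>
  Let \<open>u\<^sub>i = \<surd>A\<^sub>i \<psi>\<^sub>i\<close>, with Gram matrix \<open>G\<close>. The POVM condition says that \<open>1 - G\<close> is positive
  semidefinite, and since \<open>l \<le> d/2\<close> the complement of \<open>W\<close> has dimension at least \<open>l\<close>; hence it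
  contains vectors \<open>w\<^sub>1, \<dots>, w\<^sub>l\<close> with Gram matrix \<open>1 - G\<close> (Cholesky). The vectors \<open>u\<^sub>i + w\<^sub>i\<close> are
  then orthonormal and define a projective measurement. Applying unitaries that fix \<open>W\<close> pointwise
  keeps it projective, and averaging over a finite group of them (phases and cyclic shifts of an
  orthonormal basis of the complement of \<open>W\<close>) removes the cross terms between \<open>W\<close> and its
  complement and turns each \<open>|w\<^sub>i\<rangle>\<langle>w\<^sub>i|\<close> into \<open>\<parallel>w\<^sub>i\<parallel>\<^sup>2 = 1 - A\<^sub>i\<close> times the normalised projector.
\<close>

section \<open>Complex inner product, adjoints and rank-one matrices\<close>

lemma cinner_zero [simp]: "cinner 0 v = 0" "cinner v 0 = 0"
  by (simp_all add: cinner_def)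

lemma cinner_add_left: "cinner (u + v) w = cinner u w + cinner v w"
  by (simp add: cinner_def algebra_simps sum.distrib)

lemma cinner_add_right: "cinner w (u + v) = cinner w u + cinner w v"
  by (simp add: cinner_def algebra_simps sum.distrib)

lemma cinner_diff_right: "cinner w (u - v) = cinner w u - cinner w v"
  by (simp add: cinner_def algebra_simps sum_subtractf)

lemma cinner_scale_left: "cinner (c *s u) v = cnj c * cinner u v"
  by (simp add: cinner_def algebra_simps sum_distrib_left)

lemma cinner_scale_right: "cinner u (c *s v) = c * cinner u v"
  by (simp add: cinner_def algebra_simps sum_distrib_left)

lemma cinner_sum_left: "cinner (\<Sum>i\<in>I. f i) v = (\<Sum>i\<in>I. cinner (f i) v)"
  by (induction I rule: infinite_finite_induct) (simp_all add: cinner_add_left)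

lemma cinner_sum_right: "cinner v (\<Sum>i\<in>I. f i) = (\<Sum>i\<in>I. cinner v (f i))"
  by (induction I rule: infinite_finite_induct) (simp_all add: cinner_add_right)

lemma cnj_cinner: "cnj (cinner u v) = cinner v u"
  by (simp add: cinner_def mult.commute)

lemma cinner_self: "cinner v v = of_real ((norm v)\<^sup>2)"
proof -
  have "(norm v)\<^sup>2 = (\<Sum>i\<in>UNIV. (cmod (v$i))\<^sup>2)"
    by (simp add: norm_vec_def L2_set_def sum_nonneg)
  then show ?thesis
    by (simp add: cinner_def mult.commute[of "cnj _"] complex_norm_square del: of_real_power)
qed

lemma adjoint_mat_mult: "adjoint_mat (A ** B) = adjoint_mat B ** adjoint_mat A"
  by (simp add: adjoint_mat_def matrix_matrix_mult_def vec_eq_iff mult.commute)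

lemma adjoint_mat_sum: "adjoint_mat (\<Sum>i\<in>I. f i) = (\<Sum>i\<in>I. adjoint_mat (f i))"
  by (simp add: adjoint_mat_def vec_eq_iff)

lemma adjoint_mat_diff: "adjoint_mat (A - B) = adjoint_mat A - adjoint_mat B"
  by (simp add: adjoint_mat_def vec_eq_iff)

lemma adjoint_mat_scaleR: "adjoint_mat (c *\<^sub>R A) = c *\<^sub>R adjoint_mat A"
  by (simp add: adjoint_mat_def vec_eq_iff)

lemma adjoint_mat_one: "adjoint_mat (mat 1) = mat 1"
  by (simp add: adjoint_mat_def vec_eq_iff mat_def)

lemma adjoint_mat_outer: "adjoint_mat (outer u) = outer u"
  by (simp add: adjoint_mat_def outer_def vec_eq_iff)

lemma cinner_matrix_left: "cinner (adjoint_mat A *v u) v = cinner u (A *v v)"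
proof -
  have "cinner (adjoint_mat A *v u) v = (\<Sum>i\<in>UNIV. \<Sum>j\<in>UNIV. A$j$i * cnj (u$j) * v$i)"
    by (simp add: cinner_def matrix_vector_mult_def adjoint_mat_def sum_distrib_right)
  also have "\<dots> = (\<Sum>j\<in>UNIV. \<Sum>i\<in>UNIV. A$j$i * cnj (u$j) * v$i)"
    by (rule sum.swap)
  also have "\<dots> = cinner u (A *v v)"
    by (simp add: cinner_def matrix_vector_mult_def sum_distrib_left mult_ac)
  finally show ?thesis .
qed

lemma outer_mult_vec: "outer u *v v = cinner u v *s u"
  by (simp add: outer_def matrix_vector_mult_def cinner_def vec_eq_iff sum_distrib_right
      sum_distrib_left mult_ac)

text \<open>The scalar \<open>cinner u v\<close> is complex while \<open>*\<^sub>R\<close> scales by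
  reals, so the product is given entrywise.\<close>

lemma outer_mult_outer: "outer u ** outer v = (\<chi> i j. cinner u v * (u$i * cnj (v$j)))"
  by (simp add: outer_def matrix_matrix_mult_def cinner_def vec_eq_iff sum_distrib_right
      sum_distrib_left mult_ac)

lemma scaleR_matrix_nth: "(c *\<^sub>R A) $ i $ j = complex_of_real c * A $ i $ j"
  by (simp only: vector_scaleR_component) (rule scaleR_conv_of_real)

lemma outer_scale: "outer (c *s u) = (cmod c)\<^sup>2 *\<^sub>R outer u"
  by (simp add: vec_eq_iff scaleR_matrix_nth complex_norm_square del: of_real_power vector_scaleR_component)
    (simp add: outer_def mult_ac)

lemma matrix_vector_mult_sum_left: "(\<Sum>i\<in>I. f i) *v v = (\<Sum>i\<in>I. f i *v v)"
  for f :: "'i \<Rightarrow> complex^'n^'m"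
  by (induction I rule: infinite_finite_induct) (simp_all add: matrix_vector_mult_add_rdistrib)

lemma matrix_mult_add_left: "(A + B) ** C = A ** C + B ** C"
  for A B :: "complex^'n^'m"
  by (simp add: matrix_matrix_mult_def vec_eq_iff algebra_simps sum.distrib)

lemma matrix_mult_diff_left: "(A - B) ** C = A ** C - B ** C"
  for A B :: "complex^'n^'m"
  by (simp add: matrix_matrix_mult_def vec_eq_iff algebra_simps sum_subtractf)

lemma matrix_mult_diff_right: "A ** (B - C) = A ** B - A ** C"
  for A :: "complex^'n^'m"
  by (simp add: matrix_matrix_mult_def vec_eq_iff algebra_simps sum_subtractf)

lemma matrix_mult_sum_left: "(\<Sum>i\<in>I. f i) ** B = (\<Sum>i\<in>I. f i ** B)"
  for f :: "'i \<Rightarrow> complex^'n^'m"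
  by (induction I rule: infinite_finite_induct) (simp_all add: matrix_mult_add_left)

lemma matrix_mult_sum_right: "B ** (\<Sum>i\<in>I. f i) = (\<Sum>i\<in>I. B ** f i)"
  for f :: "'i \<Rightarrow> complex^'n^'m"
  by (induction I rule: infinite_finite_induct) (simp_all add: matrix_add_ldistrib)

section \<open>Positive semidefinite matrices and projective measurements\<close>

lemma psd_projector:
  assumes "adjoint_mat P = P" "P ** P = P"
  shows "psd P"
proof -
  have "cinner v (P *v v) = of_real ((norm (P *v v))\<^sup>2)" for v
  proof -
    have "cinner v (P *v v) = cinner v (P *v (P *v v))"
      by (simp add: matrix_vector_mul_assoc assms(2))
    also have "\<dots> = cinner (P *v v) (P *v v)"
      using cinner_matrix_left[of P v "P *v v"] by (simp add: assms(1))
    finally show ?thesis by (simp add: cinner_self)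
  qed
  then show ?thesis by (simp add: psd_def assms(1))
qed

lemma psd_weighted_sum:
  assumes "\<And>s. s \<in> I \<Longrightarrow> psd (P s)" "\<And>s. s \<in> I \<Longrightarrow> 0 \<le> p s"
  shows "psd (\<Sum>s\<in>I. p s *\<^sub>R P s)"
proof -
  have "(p s *\<^sub>R P s) *v v = of_real (p s) *s (P s *v v)" for s v
    by (simp add: vec_eq_iff matrix_vector_mult_def scaleR_matrix_nth sum_distrib_left mult_ac
        del: vector_scaleR_component)
  then have *: "cinner v ((\<Sum>s\<in>I. p s *\<^sub>R P s) *v v) = (\<Sum>s\<in>I. of_real (p s) * cinner v (P s *v v))" for v
    by (simp add: matrix_vector_mult_sum_left cinner_sum_right cinner_scale_right)
  show ?thesis
    using assms unfolding psd_def *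
    by (auto simp: adjoint_mat_sum adjoint_mat_scaleR intro!: sum_nonneg)
qed

text \<open>Reduces membership in SP(d) to exhibiting \<open>F\<close> as a uniform average of
  projective measurements with the same outcomes. The index set may have any type: a bijection with
  \<open>{1..card I}\<close> turns the average into the numbered convex combination that
  \<open>in_SP\<close> asks for.\<close>

lemma uniform_average_projective:
  fixes P :: "'s \<Rightarrow> nat \<Rightarrow> complex^'n^'n"
  assumes I: "finite I" "I \<noteq> {}"
    and P: "\<And>s. s \<in> I \<Longrightarrow> is_projective m (P s)"
    and F: "\<And>i. i \<in> {1..m} \<Longrightarrow> F i = (\<Sum>s\<in>I. (1 / real (card I)) *\<^sub>R P s i)"
  shows "is_povm m F" "in_SP m F"
proof -
  have card: "card I > 0" using I by (simp add: card_gt_0_iff)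
  have povm: "is_povm m (P s)" if "s \<in> I" for s
    using P[OF that] by (simp add: is_projective_def)
  have "(\<Sum>i\<in>{1..m}. F i) = (\<Sum>i\<in>{1..m}. \<Sum>s\<in>I. (1 / real (card I)) *\<^sub>R P s i)"
    using F by (intro sum.cong) auto
  also have "\<dots> = (\<Sum>s\<in>I. (1 / real (card I)) *\<^sub>R (\<Sum>i\<in>{1..m}. P s i))"
    by (subst sum.swap) (simp add: scaleR_sum_right)
  also have "\<dots> = (\<Sum>s\<in>I. (1 / real (card I)) *\<^sub>R mat 1)"
    using povm by (intro sum.cong) (auto simp: is_povm_def)
  also have "\<dots> = mat 1"
    using card by (simp only: sum_constant_scaleR scaleR_scaleR) simp
  finally have "(\<Sum>i\<in>{1..m}. F i) = mat 1" .
  moreover have "psd (F i)" if "i \<in> {1..m}" for i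
    unfolding F[OF that] using that povm
    by (intro psd_weighted_sum) (auto simp: is_povm_def)
  ultimately show "is_povm m F" by (simp add: is_povm_def)

  obtain h where h: "bij_betw h {1..card I} I"
    using ex_bij_betw_nat_finite_1[OF I(1)] by blast
  \<comment> \<open>Identity post-processing: outcome \<open>j\<close> is reported as
    \<open>j\<close>.\<close>
  define q where "q = (\<lambda>(r::nat) (i::nat) (j::nat). if i = j then 1 else 0 :: real)"
  have hI: "h r \<in> I" if "r \<in> {1..card I}" for r
    using h that by (meson bij_betwE)
  have q: "is_postproc m m (q r)" for r
    by (simp add: is_postproc_def q_def)
  have pq: "postproc m (q r) M i = M i" if "i \<in> {1..m}" for r i and M :: "nat \<Rightarrow> complex^'n^'n"
  proof -
    have "postproc m (q r) M i = (\<Sum>j\<in>{1..m}. if i = j then M j else 0)"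
      unfolding postproc_def q_def by (intro sum.cong) auto
    then show ?thesis using that by simp
  qed
  have "F i = (\<Sum>r\<in>{1..card I}. (1 / real (card I)) *\<^sub>R postproc m (q r) (P (h r)) i)"
    if "i \<in> {1..m}" for i
    using sum.reindex_bij_betw[OF h, of "\<lambda>s. (1 / real (card I)) *\<^sub>R P s i"]
    by (simp only: pq[OF that] F[OF that])
  then show "in_SP m F"
    unfolding in_SP_def using card P hI q
    by (intro exI[of _ "card I"] exI[of _ "\<lambda>_. 1 / real (card I)"] exI[of _ "\<lambda>_. m"]
        exI[of _ "\<lambda>r. P (h r)"] exI[of _ q]) auto
qed

text \<open>The rank-one projectors multiply like a Kronecker delta, so their sum \<open>S\<close>
  is idempotent and absorbs each of them on both sides; hence \<open>mat 1 - S\<close> is idempotent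
  and annihilates them. Positivity then comes for free from self-adjointness and
  idempotence.\<close>

lemma projective_of_orthonormal:
  fixes e :: "nat \<Rightarrow> complex^'n"
  assumes e: "\<And>i k. i \<in> {1..l} \<Longrightarrow> k \<in> {1..l} \<Longrightarrow> cinner (e i) (e k) = (if i = k then 1 else 0)"
  shows "is_projective (l + 1) (\<lambda>i. if i \<le> l then outer (e i) else mat 1 - (\<Sum>k\<in>{1..l}. outer (e k)))"
    (is "is_projective _ ?P")
proof -
  define S where "S = (\<Sum>k\<in>{1..l}. outer (e k))"
  have ee: "outer (e i) ** outer (e k) = (if i = k then outer (e i) else 0)"
    if "i \<in> {1..l}" "k \<in> {1..l}" for i k
    using that by (simp add: outer_mult_outer e) (simp_all add: outer_def vec_eq_iff)
  have eS: "outer (e i) ** S = outer (e i)" if "i \<in> {1..l}" for i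
  proof -
    have "outer (e i) ** S = (\<Sum>k\<in>{1..l}. if i = k then outer (e i) else 0)"
      unfolding S_def matrix_mult_sum_right using that ee by (intro sum.cong) auto
    then show ?thesis using that by simp
  qed
  have Se: "S ** outer (e i) = outer (e i)" if "i \<in> {1..l}" for i
  proof -
    have "S ** outer (e i) = (\<Sum>k\<in>{1..l}. if k = i then outer (e i) else 0)"
      unfolding S_def matrix_mult_sum_left using that ee by (intro sum.cong) auto
    then show ?thesis using that by simp
  qed
  have SS: "S ** S = S"
  proof -
    have "S ** S = (\<Sum>k\<in>{1..l}. S ** outer (e k))"
      by (subst (2) S_def) (rule matrix_mult_sum_right)
    also have "\<dots> = S"
      unfolding S_def[THEN sym] using Se by (subst (2) S_def) (intro sum.cong; simp)
    finally show ?thesis .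
  qed
  have S1: "S ** (mat 1 - S) = 0" "(mat 1 - S) ** (mat 1 - S) = mat 1 - S"
    by (simp_all add: matrix_mult_diff_left matrix_mult_diff_right SS)
  have mult: "?P i ** ?P j = (if i = j then ?P i else 0)"
    if "i \<in> {1..l+1}" "j \<in> {1..l+1}" for i j
    using that ee[of i j] eS[of i] Se[of j] S1
    unfolding S_def[symmetric] by (auto simp: matrix_mult_diff_left matrix_mult_diff_right)
  have adj: "adjoint_mat (?P i) = ?P i" for i
    by (simp add: adjoint_mat_diff adjoint_mat_sum adjoint_mat_one adjoint_mat_outer)
  have "psd (?P i)" if "i \<in> {1..l+1}" for i
    using adj mult[OF that that] by (intro psd_projector) simp_all
  moreover have "(\<Sum>i\<in>{1..l+1}. ?P i) = mat 1"
    by simp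
  ultimately show ?thesis
    using mult unfolding is_projective_def is_povm_def by blast
qed

section \<open>Orthonormal bases, dimensions and orthogonal projectors\<close>

definition corthonormal :: "(complex^'n) set \<Rightarrow> bool" where
  "corthonormal T \<longleftrightarrow> (\<forall>u\<in>T. \<forall>v\<in>T. cinner u v = (if u = v then 1 else 0))"

lemma corthonormal_independent:
  assumes "corthonormal T"
  shows "vec.independent T"
  unfolding vec.dependent_explicit
proof safe
  fix t c v
  assume t: "finite t" "t \<subseteq> T" "(\<Sum>v\<in>t. c v *s v) = 0" "v \<in> t" "c v \<noteq> 0"
  have "0 = cinner v (\<Sum>w\<in>t. c w *s w)" by (simp add: t)
  also have "\<dots> = (\<Sum>w\<in>t. if v = w then c w else 0)"
    unfolding cinner_sum_right cinner_scale_right using assms t(2,4)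
    by (intro sum.cong) (auto simp: corthonormal_def subset_iff)
  also have "\<dots> = c v" using t by simp
  finally show False using t by simp
qed

text \<open>The Gram-Schmidt residual. It serves both to extend orthonormal sets and to split a
  vector along \<open>W\<close> and its complement.\<close>

lemma corthonormal_projection:
  assumes "corthonormal T" "finite T" "u \<in> T"
  shows "cinner u (v - (\<Sum>w\<in>T. cinner w v *s w)) = 0"
proof -
  have "cinner u (\<Sum>w\<in>T. cinner w v *s w) = (\<Sum>w\<in>T. if u = w then cinner w v else 0)"
    unfolding cinner_sum_right cinner_scale_right using assms
    by (intro sum.cong) (auto simp: corthonormal_def)
  then show ?thesis using assms by (simp add: cinner_diff_right)
qed

lemma corthonormal_basis_exists:
  fixes U :: "(complex^'n) set"
  assumes U: "vec.subspace U"
  obtains T where "corthonormal T" "finite T" "vec.span T = U" "card T = vec.dim U"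
proof -
  let ?Q = "\<lambda>T. corthonormal T \<and> T \<subseteq> U"
  have bound: "finite T \<and> card T \<le> vec.dim (UNIV :: (complex^'n) set)" if "?Q T" for T
    using vec.independent_card_le_dim[OF _ corthonormal_independent, of T UNIV]
      vec.finiteI_independent[OF corthonormal_independent, of T] that by auto
  have "?Q {}" by (simp add: corthonormal_def)
  then obtain T where T: "?Q T" and max: "\<And>T'. ?Q T' \<Longrightarrow> card T' \<le> card T"
    using ex_has_greatest_nat[of ?Q "{}" card "Suc (vec.dim (UNIV :: (complex^'n) set))"] bound
    by (metis le_SucI less_Suc_eq_le)
  have fin: "finite T" using bound[OF T] by simp
  have "U \<subseteq> vec.span T"
  proof
    fix v assume v: "v \<in> U"
    define w where "w = v - (\<Sum>t\<in>T. cinner t v *s t)"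
    have orth: "cinner t w = 0" "cinner w t = 0" if "t \<in> T" for t
      using corthonormal_projection[OF _ fin that] T cnj_cinner[of t w] unfolding w_def
      by (metis complex_cnj_zero)+
    have sumU: "(\<Sum>t\<in>T. cinner t v *s t) \<in> U"
      using T U by (intro vec.subspace_sum vec.subspace_scale) auto
    have wU: "w \<in> U"
      unfolding w_def using v sumU U by (intro vec.subspace_diff)
    have "w = 0"
    proof (rule ccontr)
      assume "w \<noteq> 0"
      define z where "z = complex_of_real (1 / norm w) *s w"
      have zz: "cinner z z = 1"
        using \<open>w \<noteq> 0\<close> unfolding z_def cinner_scale_left unfolding cinner_scale_right unfolding cinner_self
        by (simp add: power2_eq_square)
      have "z \<notin> T"
        using orth(1)[of z] zz by (auto simp: z_def cinner_scale_right)
      have "?Q (insert z T)"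
      proof
        have "cinner t z = 0" "cinner z t = 0" if "t \<in> T" for t
          using orth[OF that] by (simp_all add: z_def cinner_scale_left cinner_scale_right)
        then show "corthonormal (insert z T)"
          using T zz \<open>z \<notin> T\<close> by (auto simp: corthonormal_def)
        show "insert z T \<subseteq> U"
          using T wU U by (auto simp: z_def intro: vec.subspace_scale)
      qed
      then have "card (insert z T) \<le> card T" by (rule max)
      then show False using \<open>z \<notin> T\<close> fin by simp
    qed
    then have "v = (\<Sum>t\<in>T. cinner t v *s t)" by (simp add: w_def)
    also have "\<dots> \<in> vec.span T"
      by (intro vec.span_sum vec.span_scale vec.span_base)
    finally show "v \<in> vec.span T" .
  qed
  then have "vec.span T = U"
    using T U by (simp add: subset_antisym vec.span_minimal)
  moreover have "card T = vec.dim U"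
    using T corthonormal_independent \<open>U \<subseteq> vec.span T\<close> by (metis vec.basis_card_eq_dim)
  ultimately show thesis using that T fin by blast
qed

lemma span_finiteE:
  fixes T :: "(complex^'n) set"
  assumes "finite T" "v \<in> vec.span T"
  obtains c where "v = (\<Sum>t\<in>T. c t *s t)"
  using assms(2) unfolding vec.span_finite[OF assms(1)] by (rule imageE)

lemma cspan_eq_span: "cspan S = vec.span S"
  unfolding cspan_def vec.span_explicit by blast

text \<open>An orthonormal basis attains the minimum, and no finite spanning set is smaller than the
  dimension.\<close>

lemma cdim_eq_dim:
  assumes "vec.subspace U"
  shows "cdim U = vec.dim U"
  unfolding cdim_def
proof (rule Least_equality)
  show "\<exists>T. finite T \<and> card T = vec.dim U \<and> cspan T = U"
    using corthonormal_basis_exists[OF assms] unfolding cspan_eq_span by metis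
  show "vec.dim U \<le> k" if "\<exists>T. finite T \<and> card T = k \<and> cspan T = U" for k
    using that vec.dim_le_card unfolding cspan_eq_span by (metis order_refl)
qed

lemma subspace_corth: "vec.subspace (corth W)"
  by (auto simp: corth_def vec.subspace_def cinner_add_right cinner_scale_right)

text \<open>Every \<open>v\<close> is its projection to \<open>W\<close> plus a residual in the
  complement, so orthonormal bases of the two subspaces together span the whole space.\<close>

lemma dim_corth_ge:
  fixes W :: "(complex^'n) set"
  assumes "vec.subspace W"
  shows "CARD('n) \<le> vec.dim W + vec.dim (corth W)"
proof -
  obtain T where T: "corthonormal T" "finite T" "vec.span T = W" "card T = vec.dim W"
    using corthonormal_basis_exists[OF assms] .
  obtain T' where T': "finite T'" "vec.span T' = corth W" "card T' = vec.dim (corth W)"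
    using corthonormal_basis_exists[OF subspace_corth] by metis
  have "v \<in> vec.span (T \<union> T')" for v
  proof -
    define w where "w = (\<Sum>t\<in>T. cinner t v *s t)"
    have "w \<in> vec.span T"
      unfolding w_def by (intro vec.span_sum vec.span_scale vec.span_base)
    have "cinner u (v - w) = 0" if u: "u \<in> W" for u
    proof -
      obtain c where "u = (\<Sum>t\<in>T. c t *s t)"
        using span_finiteE[OF T(2)] u T(3) by metis
      then show ?thesis
        using corthonormal_projection[OF T(1,2)] by (simp add: w_def cinner_sum_left cinner_scale_left)
    qed
    then have "v - w \<in> vec.span T'" by (simp add: T' corth_def)
    then have "w + (v - w) \<in> vec.span (T \<union> T')"
      using \<open>w \<in> vec.span T\<close> by (meson subsetD Un_upper1 Un_upper2 vec.span_add vec.span_mono)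
    then show ?thesis by simp
  qed
  then have "vec.dim (UNIV :: (complex^'n) set) \<le> card (T \<union> T')"
    using T T' by (intro vec.dim_le_card) auto
  also have "\<dots> \<le> card T + card T'" by (rule card_Un_le)
  finally show ?thesis by (simp add: T T' card_cart_basis)
qed

text \<open>The description by \<open>THE\<close> requires uniqueness as well. If \<open>P\<close>
  is the sum and \<open>Q\<close> another self-adjoint idempotent with the same range, each fixes
  the range of the other: \<open>P ** Q = Q\<close> and \<open>Q ** P = P\<close>. Taking adjoints
  in the first gives \<open>Q ** P = Q\<close>, so both agree.\<close>

lemma orth_proj_span:
  assumes T: "corthonormal T" "finite T"
  shows "orth_proj (vec.span T) = (\<Sum>t\<in>T. outer t)"
  unfolding orth_proj_def
proof (rule the_equality)
  let ?P = "\<Sum>t\<in>T. outer t"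
  have app: "?P *v v = (\<Sum>t\<in>T. cinner t v *s t)" for v
    by (simp add: matrix_vector_mult_sum_left outer_mult_vec)
  have idem: "?P *v v = v" if v_span: "v \<in> vec.span T" for v
  proof -
    obtain c where v: "v = (\<Sum>t\<in>T. c t *s t)"
      using span_finiteE[OF T(2) v_span] .
    have "cinner t v = c t" if "t \<in> T" for t
    proof -
      have "cinner t v = (\<Sum>w\<in>T. if t = w then c w else 0)"
        unfolding v cinner_sum_right cinner_scale_right using T that
        by (intro sum.cong) (auto simp: corthonormal_def)
      then show ?thesis using T that by simp
    qed
    then show ?thesis by (simp add: app v cong: sum.cong)
  qed
  have range: "?P *v v \<in> vec.span T" for v
    unfolding app by (intro vec.span_sum vec.span_scale vec.span_base)
  have adj: "adjoint_mat ?P = ?P" by (simp add: adjoint_mat_sum adjoint_mat_outer)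
  show "adjoint_mat ?P = ?P \<and> ?P ** ?P = ?P \<and> range (\<lambda>v. ?P *v v) = vec.span T"
  proof (intro conjI adj)
    show "?P ** ?P = ?P"
      unfolding matrix_eq by (simp add: idem range flip: matrix_vector_mul_assoc)
    show "range (\<lambda>v. ?P *v v) = vec.span T"
    proof
      show "range (\<lambda>v. ?P *v v) \<subseteq> vec.span T" using range by blast
      show "vec.span T \<subseteq> range (\<lambda>v. ?P *v v)" by (intro subsetI range_eqI) (rule idem[symmetric])
    qed
  qed
  fix Q assume Q: "adjoint_mat Q = Q \<and> Q ** Q = Q \<and> range (\<lambda>v. Q *v v) = vec.span T"
  have "?P ** Q = Q"
    unfolding matrix_eq matrix_vector_mul_assoc[symmetric] using Q by (intro allI idem) blast
  then have "Q ** ?P = Q"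
    using Q adj adjoint_mat_mult by metis
  moreover have "Q ** ?P = ?P"
  proof -
    have "Q *v (?P *v v) = ?P *v v" for v
    proof -
      have "?P *v v \<in> range (\<lambda>v. Q *v v)" using range[of v] Q by simp
      then obtain w where "?P *v v = Q *v w" by (rule imageE)
      then show ?thesis using Q by (simp add: matrix_vector_mul_assoc)
    qed
    then show ?thesis unfolding matrix_eq by (simp flip: matrix_vector_mul_assoc)
  qed
  ultimately show "Q = ?P" by simp
qed

section \<open>Gram matrices\<close>

text \<open>Cholesky factorisation by induction on the index set: eliminate one pivot, factor the
  Schur complement, and add one new coordinate for the pivot. The coordinates are indexed by
  \<open>S\<close> itself, so as many dimensions suffice as there are vectors.\<close>

lemma gram_factorization:
  fixes H :: "'i \<Rightarrow> 'i \<Rightarrow> complex"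
  assumes "finite S"
    and "\<And>i k. i \<in> S \<Longrightarrow> k \<in> S \<Longrightarrow> H k i = cnj (H i k)"
    and "\<And>x. 0 \<le> Re (\<Sum>i\<in>S. \<Sum>k\<in>S. cnj (x i) * H i k * x k)"
  shows "\<exists>c. \<forall>i\<in>S. \<forall>k\<in>S. (\<Sum>j\<in>S. cnj (c i j) * c k j) = H i k"
  using assms
proof (induction S arbitrary: H rule: finite_induct)
  case empty
  then show ?case by simp
next
  case (insert n S)
  have herm: "H k i = cnj (H i k)" if "i \<in> insert n S" "k \<in> insert n S" for i k
    using insert.prems(1) that by blast
  define h where "h = Re (H n n)"
  have hn: "H n n = of_real h"
    using herm[of n n] by (simp add: h_def complex_eq_iff)
  define y where "y = (\<lambda>x. \<Sum>k\<in>S. H n k * x k)"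
  define Q where "Q = (\<lambda>x. \<Sum>i\<in>S. \<Sum>k\<in>S. cnj (x i) * H i k * x k)"
  have cy: "cnj (y x) = (\<Sum>i\<in>S. cnj (x i) * H i n)" for x
    unfolding y_def cnj_sum
  proof (rule sum.cong)
    fix i assume "i \<in> S"
    then show "cnj (H n i * x i) = cnj (x i) * H i n"
      using herm[of n i] by simp
  qed simp
  \<comment> \<open>The form is evaluated at \<open>x\<close> with entry \<open>n\<close> replaced
    by \<open>z\<close>. The result is a quadratic in \<open>z\<close>, where \<open>Q x\<close> is
    the form on \<open>S\<close> and \<open>y x\<close> pairs row \<open>n\<close> with
    \<open>x\<close>.\<close>
  have pos: "0 \<le> Re (Q x) + 2 * Re (cnj z * y x) + h * (cmod z)\<^sup>2" for x z
  proof -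
    let ?x = "x(n := z)"
    have eq: "?x i = x i" if "i \<in> S" for i
      using that insert.hyps by auto
    have "(\<Sum>i\<in>insert n S. \<Sum>k\<in>insert n S. cnj (?x i) * H i k * ?x k)
        = (cnj z * H n n * z + (\<Sum>k\<in>S. cnj z * H n k * x k))
          + (\<Sum>i\<in>S. cnj (x i) * H i n * z + (\<Sum>k\<in>S. cnj (x i) * H i k * x k))"
      using insert.hyps by (simp add: eq del: fun_upd_apply cong: sum.cong) simp
    also have "\<dots> = Q x + (cnj z * y x + cnj (cnj z * y x)) + of_real (h * (cmod z)\<^sup>2)"
      unfolding complex_cnj_mult cy of_real_mult complex_norm_square
      by (simp add: Q_def y_def sum.distrib hn sum_distrib_left algebra_simps)
    finally show ?thesis
      using insert.prems(2)[of ?x] by simp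
  qed
  have h0: "h \<ge> 0"
    using pos[of "\<lambda>_. 0" 1] by (simp add: Q_def y_def)
  \<comment> \<open>With a zero pivot the expression in \<open>pos\<close> is affine in
    \<open>z\<close>, and it stays nonnegative only if its linear coefficient vanishes. The unit
    vector at \<open>k\<close> isolates the entry \<open>H n k\<close>.\<close>
  have row0: "H n k = 0" if "h = 0" "k \<in> S" for k
  proof -
    define x where "x = (\<lambda>i. if i = k then 1 else 0 :: complex)"
    have "y x = (\<Sum>i\<in>S. if i = k then H n i else 0)"
      unfolding y_def x_def by (intro sum.cong) auto
    then have yx: "y x = H n k" using that insert.hyps by simp
    have Q0: "0 \<le> Re (Q x)" using pos[of x 0] by simp
    show ?thesis
    proof (rule ccontr)
      assume "H n k \<noteq> 0"
      \<comment> \<open>Chosen so that the linear term equals \<open>- 2 * (Re (Q x) + 1)\<close>,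
        which outweighs \<open>Re (Q x)\<close>.\<close>
      define t where "t = (Re (Q x) + 1) / (cmod (y x))\<^sup>2"
      have "Re (cnj (- of_real t * y x) * y x) = - t * (cmod (y x))\<^sup>2"
        by (simp add: cmod_power2) (simp add: power2_eq_square algebra_simps)
      also have "\<dots> = - (Re (Q x) + 1)"
        using \<open>H n k \<noteq> 0\<close> by (simp add: t_def yx)
      finally show False
        using pos[of x "- of_real t * y x"] that Q0 by simp
    qed
  qed
  \<comment> \<open>Schur complement of the pivot \<^term>\<open>H n n\<close>; for \<^prop>\<open>h = 0\<close> the convention
    \<open>x / 0 = 0\<close> leaves \<^term>\<open>H\<close> unchanged, which is right since the row \<^term>\<open>n\<close> then vanishes.\<close>
  define H' where "H' = (\<lambda>i k. H i k - H i n * H n k / of_real h)"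
  have "\<exists>c. \<forall>i\<in>S. \<forall>k\<in>S. (\<Sum>j\<in>S. cnj (c i j) * c k j) = H' i k"
  proof (rule insert.IH)
    show "H' k i = cnj (H' i k)" if "i \<in> S" "k \<in> S" for i k
      using that herm[of i k] herm[of n k] herm[of n i] by (simp add: H'_def)
    show "0 \<le> Re (\<Sum>i\<in>S. \<Sum>k\<in>S. cnj (x i) * H' i k * x k)" for x
    proof -
      have "(\<Sum>i\<in>S. \<Sum>k\<in>S. cnj (x i) * H' i k * x k)
          = Q x - (\<Sum>i\<in>S. \<Sum>k\<in>S. (cnj (x i) * H i n) * (H n k * x k)) / of_real h"
        unfolding Q_def H'_def sum_divide_distrib sum_subtractf[symmetric]
        by (intro sum.cong refl) (simp add: algebra_simps)
      also have "\<dots> = Q x - cnj (y x) * y x / of_real h"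
        unfolding cy unfolding y_def by (simp only: sum_product)
      also have "cnj (y x) * y x / of_real h = of_real ((cmod (y x))\<^sup>2 / h)"
        by (simp add: complex_norm_square mult.commute del: of_real_power)
      finally have *: "Re (\<Sum>i\<in>S. \<Sum>k\<in>S. cnj (x i) * H' i k * x k) = Re (Q x) - (cmod (y x))\<^sup>2 / h"
        by simp
      \<comment> \<open>Completing the square: for \<open>h > 0\<close> the value
        \<open>z = - y x / h\<close> minimises the quadratic in \<open>pos\<close>, and the minimum
        is the form of \<open>H'\<close>. For \<open>h = 0\<close> it is \<open>z = 0\<close>, and
        both are \<open>Re (Q x)\<close>.\<close>
      have "cnj (- y x / of_real h) * y x = of_real (- ((cmod (y x))\<^sup>2 / h))"
        by (simp add: complex_norm_square mult.commute del: of_real_power)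
      then have "Re (cnj (- y x / of_real h) * y x) = - ((cmod (y x))\<^sup>2 / h)"
        by (simp only: Re_complex_of_real)
      moreover have "h * (cmod (- y x / of_real h))\<^sup>2 = (cmod (y x))\<^sup>2 / h"
        using h0 by (simp add: norm_divide power2_eq_square)
      ultimately show ?thesis
        using pos[of x "- y x / of_real h"] unfolding * by linarith
    qed
  qed
  then obtain c where c: "\<And>i k. i \<in> S \<Longrightarrow> k \<in> S \<Longrightarrow> (\<Sum>j\<in>S. cnj (c i j) * c k j) = H' i k"
    by blast
  \<comment> \<open>The new coordinate \<open>n\<close> carries the pivot column divided by the root
    of the pivot, and vector \<open>n\<close> has no other coordinate. The entry is
    \<open>H n i\<close>, not \<open>H i n\<close>, because the Gram sum conjugates its first
    factor.\<close>
  define d where "d = (\<lambda>i j. if i = n then (if j = n then of_real (sqrt h) else 0)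
      else if j = n then H n i / of_real (sqrt h) else c i j)"
  have sq: "complex_of_real (sqrt h) * of_real (sqrt h) = of_real h"
    using h0 by (simp flip: of_real_mult)
  have dn: "cnj (d i n) * d k n = H i n * H n k / of_real h" if "i \<in> S" "k \<in> S" for i k
    using that insert.hyps herm[of n i] by (auto simp: d_def sq)
  have dS: "(\<Sum>j\<in>S. cnj (d i j) * d k j) = (if i = n \<or> k = n then 0 else \<Sum>j\<in>S. cnj (c i j) * c k j)" for i k
    using insert.hyps by (auto simp: d_def intro!: sum.neutral sum.cong)
  have "(\<Sum>j\<in>insert n S. cnj (d i j) * d k j) = H i k"
    if ik: "i \<in> insert n S" "k \<in> insert n S" for i k
  proof -
    have sum: "(\<Sum>j\<in>insert n S. cnj (d i j) * d k j) = cnj (d i n) * d k n + (\<Sum>j\<in>S. cnj (d i j) * d k j)"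
      using insert.hyps by simp
    consider "i = n" "k = n" | "i = n" "k \<in> S" "k \<noteq> n" | "i \<in> S" "i \<noteq> n" "k = n"
      | "i \<in> S" "k \<in> S" "i \<noteq> n" "k \<noteq> n"
      using ik insert.hyps by blast
    then show ?thesis
    proof cases
      case 1
      then show ?thesis unfolding sum dS by (simp add: d_def sq hn)
    next
      case 2
      then show ?thesis unfolding sum dS using row0[of k] by (auto simp: d_def)
    next
      case 3
      then show ?thesis unfolding sum dS using row0[of i] herm[of n i] by (auto simp: d_def)
    next
      case 4
      then show ?thesis unfolding sum dS by (simp add: dn c H'_def)
    qed
  qed
  then show ?case by blast
qed

section \<open>Averages over phases and cyclic shifts\<close>

text \<open>The summand is the power \<open>b\<close> of the ratio \<open>\<zeta>\<close> of two
  \<open>M\<close>-th roots of unity. For distinct indices \<open>\<zeta>\<close> differs from 1 and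
  its geometric sum vanishes.\<close>

lemma sum_roots_of_unity_orthogonal:
  fixes j k M :: nat
  defines "\<omega> \<equiv> \<lambda>j. cis (2 * pi * real j / real M)"
  assumes "j < M" "k < M"
  shows "(\<Sum>b<M. \<omega> j ^ b * cnj (\<omega> k ^ b)) = (if j = k then of_nat M else 0)"
proof -
  define \<zeta> where "\<zeta> = \<omega> j * cnj (\<omega> k)"
  have bij: "bij_betw \<omega> {..<M} {z. z ^ M = 1}"
    unfolding \<omega>_def by (rule Complex.bij_betw_roots_unity) (use assms(2) in simp)
  have root: "\<omega> i ^ M = 1" if "i < M" for i
    using bij_betwE[OF bij] that by auto
  have unit: "\<omega> i * cnj (\<omega> i) = 1" for i
    by (simp add: \<omega>_def flip: complex_norm_square)
  have "(\<Sum>b<M. \<omega> j ^ b * cnj (\<omega> k ^ b)) = (\<Sum>b<M. \<zeta> ^ b)"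
    by (simp add: \<zeta>_def power_mult_distrib)
  also have "\<dots> = (if j = k then of_nat M else 0)"
  proof (cases "j = k")
    case True
    then show ?thesis by (simp add: \<zeta>_def unit)
  next
    case False
    have "\<zeta> \<noteq> 1"
    proof
      assume "\<zeta> = 1"
      then have "\<omega> j = \<omega> k"
        using unit[of k] unfolding \<zeta>_def by (metis mult.assoc mult.commute mult.right_neutral)
      then show False
        using False bij assms by (auto simp: bij_betw_def inj_on_def)
    qed
    moreover have "\<zeta> ^ M = 1"
      using root[OF assms(2)] root[OF assms(3)]
      by (simp add: \<zeta>_def power_mult_distrib flip: complex_cnj_power)
    ultimately show ?thesis using False by (simp add: geometric_sum)
  qed
  finally show ?thesis .
qed

text \<open>Expanding the outer product, the term with indices \<open>j\<close> and \<open>k\<close>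
  carries a product of characters in \<open>b\<close>; summing over \<open>b\<close> leaves only the
  diagonal, \<open>M\<close> times.\<close>

lemma sum_outer_dft:
  fixes g :: "nat \<Rightarrow> complex^'n"
  shows "(\<Sum>b<M. outer (\<Sum>j<M. cis (2 * pi * real j / real M) ^ b *s g j))
    = real M *\<^sub>R (\<Sum>j<M. outer (g j))"
proof -
  define \<omega> where "\<omega> = (\<lambda>j. cis (2 * pi * real j / real M))"
  have "(\<Sum>b<M. (\<Sum>j<M. \<omega> j ^ b * g j $ r) * cnj (\<Sum>k<M. \<omega> k ^ b * g k $ s))
      = of_nat M * (\<Sum>j<M. g j $ r * cnj (g j $ s))" for r s
  proof -
    have "(\<Sum>b<M. (\<Sum>j<M. \<omega> j ^ b * g j $ r) * cnj (\<Sum>k<M. \<omega> k ^ b * g k $ s))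
        = (\<Sum>b<M. \<Sum>j<M. \<Sum>k<M. (\<omega> j ^ b * cnj (\<omega> k ^ b)) * (g j $ r * cnj (g k $ s)))"
      by (simp add: sum_product mult_ac)
    also have "\<dots> = (\<Sum>j<M. \<Sum>k<M. \<Sum>b<M. (\<omega> j ^ b * cnj (\<omega> k ^ b)) * (g j $ r * cnj (g k $ s)))"
      by (subst sum.swap, rule sum.cong[OF refl], rule sum.swap)
    also have "\<dots> = (\<Sum>j<M. \<Sum>k<M. if j = k then of_nat M * (g j $ r * cnj (g k $ s)) else 0)"
      unfolding sum_distrib_right[symmetric] \<omega>_def
      by (intro sum.cong refl) (simp add: sum_roots_of_unity_orthogonal del: complex_cnj_power)
    also have "\<dots> = of_nat M * (\<Sum>j<M. g j $ r * cnj (g j $ s))"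
      by (simp add: sum_distrib_left)
    finally show ?thesis .
  qed
  then show ?thesis
    by (simp add: vec_eq_iff scaleR_matrix_nth del: vector_scaleR_component)
      (simp add: outer_def \<omega>_def)
qed

lemma sum_shift_mod:
  fixes h :: "nat \<Rightarrow> 'a::comm_monoid_add"
  shows "(\<Sum>a<D. h ((j + a) mod D)) = (\<Sum>a<D. h a)"
proof (cases "D = 0")
  case False
  have "inj_on (\<lambda>a. (j + a) mod D) {..<D}"
  proof (rule inj_onI)
    fix x y assume xy: "x \<in> {..<D}" "y \<in> {..<D}" "(j + x) mod D = (j + y) mod D"
    then have "(j + x + (D - j mod D)) mod D = (j + y + (D - j mod D)) mod D"
      by (metis mod_add_left_eq)
    \<comment> \<open>Adding \<open>D - j mod D\<close> undoes the shift by \<open>j\<close> modulo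
      \<open>D\<close>.\<close>
    moreover have "(j + z + (D - j mod D)) mod D = z" if "z < D" for z
    proof -
      have "j + z + (D - j mod D) = z + D * (j div D + 1)"
        using mult_div_mod_eq[of D j] mod_less_divisor[of D j] False unfolding distrib_left by linarith
      then show ?thesis using that by (metis mod_less mod_mult_self2)
    qed
    ultimately show "x = y" using xy by simp
  qed
  then have "bij_betw (\<lambda>a. (j + a) mod D) {..<D} {..<D}"
    using False unfolding bij_betw_def
    by (intro conjI endo_inj_surj) auto
  then show ?thesis by (rule sum.reindex_bij_betw)
qed simp

section \<open>Bessel bounds and the assembly of the decomposition\<close>

text \<open>Duality: the map from coefficients to vectors is adjoint to
  \<open>v \<mapsto> (cinner (u i) v)\<close>, so it is a contraction too. Concretely,
  Cauchy-Schwarz and the Bessel bound at \<open>v = (\<Sum>i\<in>I. x i *s u i)\<close> bound the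
  fourth power of its norm by the coefficient sum times its squared norm, which cancels unless
  \<open>v = 0\<close>.\<close>

lemma contraction_of_bessel:
  assumes bessel: "\<And>v. (\<Sum>i\<in>I. (cmod (cinner (u i) v))\<^sup>2) \<le> (norm v)\<^sup>2"
  shows "(norm (\<Sum>i\<in>I. x i *s u i))\<^sup>2 \<le> (\<Sum>i\<in>I. (cmod (x i))\<^sup>2)"
proof -
  define v where "v = (\<Sum>i\<in>I. x i *s u i)"
  define X where "X = (\<Sum>i\<in>I. (cmod (x i))\<^sup>2)"
  have "(norm v)\<^sup>2 = cmod (cinner v v)"
    by (simp add: cinner_self norm_power)
  also have "cinner v v = (\<Sum>i\<in>I. x i * cinner v (u i))"
    by (subst (2) v_def) (simp add: cinner_sum_right cinner_scale_right)
  also have "cmod \<dots> \<le> (\<Sum>i\<in>I. cmod (x i) * cmod (cinner (u i) v))"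
    by (rule order_trans[OF norm_sum]) (simp add: norm_mult flip: cnj_cinner[of v])
  finally have "((norm v)\<^sup>2)\<^sup>2 \<le> (\<Sum>i\<in>I. cmod (x i) * cmod (cinner (u i) v))\<^sup>2"
    by (rule power_mono) simp
  also have "\<dots> \<le> X * (\<Sum>i\<in>I. (cmod (cinner (u i) v))\<^sup>2)"
    unfolding X_def by (rule Cauchy_Schwarz_ineq_sum)
  also have "\<dots> \<le> X * (norm v)\<^sup>2"
    using bessel by (intro mult_left_mono) (auto simp: X_def sum_nonneg)
  finally have "(norm v)\<^sup>2 * (norm v)\<^sup>2 \<le> X * (norm v)\<^sup>2"
    by (simp only: power2_eq_square[of "(norm v)\<^sup>2"])
  moreover have "0 \<le> X" by (simp add: X_def sum_nonneg)
  ultimately have "(norm v)\<^sup>2 \<le> X"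
    by (cases "v = 0") (simp_all only: mult_le_cancel_right_pos zero_less_norm_iff zero_less_power norm_zero simp_thms, simp)
  then show ?thesis by (simp add: v_def X_def)
qed

theorem theorem6:
  fixes l :: nat
    and N :: "nat \<Rightarrow> complex^'n^'n"
    and A :: "nat \<Rightarrow> real"
    and \<psi> :: "nat \<Rightarrow> complex^'n"
    and F :: "nat \<Rightarrow> complex^'n^'n"
  assumes "2 * l \<le> CARD('n)"
    and "is_povm (l + 1) N"
    and "\<forall>i\<in>{1..l}. norm (\<psi> i) = 1"
    and "\<forall>i\<in>{1..l}. 0 \<le> A i"
    and "\<forall>i\<in>{1..l}. N i = A i *\<^sub>R outer (\<psi> i)"
    and "\<forall>i\<in>{1..l}. F i = A i *\<^sub>R outer (\<psi> i)
            + ((1 - A i) / real (cdim (corth (cspan (\<psi> ` {1..l}))))) *\<^sub>R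
                orth_proj (corth (cspan (\<psi> ` {1..l})))"
    and "F (l + 1) = mat 1 - (\<Sum>i\<in>{1..l}. F i)"
  shows "is_povm (l + 1) F \<and> in_SP (l + 1) F"
proof -
  define u where "u = (\<lambda>i. complex_of_real (sqrt (A i)) *s \<psi> i)"
  have outer_u: "outer (u i) = A i *\<^sub>R outer (\<psi> i)" if "i \<in> {1..l}" for i
    using that assms(4) by (simp add: u_def outer_scale)
  have uu: "cinner (u i) (u i) = of_real (A i)" if "i \<in> {1..l}" for i
    using that assms(3,4) unfolding u_def cinner_scale_left unfolding cinner_scale_right unfolding cinner_self
    by (simp flip: of_real_mult)

  \<comment> \<open>This is positivity of the last effect \<open>N (l + 1)\<close>, the identity
    minus the sum of the \<open>outer (u i)\<close>.\<close>
  have bessel: "(\<Sum>i\<in>{1..l}. (cmod (cinner (u i) v))\<^sup>2) \<le> (norm v)\<^sup>2" for v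
  proof -
    have "(\<Sum>i\<in>{1..l}. outer (u i)) + N (l + 1) = (\<Sum>i\<in>{1..l+1}. N i)"
      using sum.cong[of "{1..l}" _ "\<lambda>i. outer (u i)" N] assms(5) outer_u by simp
    then have "N (l + 1) = mat 1 - (\<Sum>i\<in>{1..l}. outer (u i))"
      using assms(2) unfolding is_povm_def by (metis add_diff_cancel_left')
    then have "cinner v (N (l + 1) *v v) = cinner v v - (\<Sum>i\<in>{1..l}. cinner v (outer (u i) *v v))"
      by (simp add: matrix_vector_mult_diff_rdistrib matrix_vector_mult_sum_left cinner_diff_right cinner_sum_right)
    also have "\<dots> = of_real ((norm v)\<^sup>2 - (\<Sum>i\<in>{1..l}. (cmod (cinner (u i) v))\<^sup>2))"
      unfolding of_real_diff of_real_sum complex_norm_square cinner_self[symmetric]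
      by (simp add: outer_mult_vec cinner_scale_right cnj_cinner)
    finally have "Re (cinner v (N (l + 1) *v v)) = (norm v)\<^sup>2 - (\<Sum>i\<in>{1..l}. (cmod (cinner (u i) v))\<^sup>2)"
      by (simp only: Re_complex_of_real)
    moreover have "psd (N (l + 1))"
      using assms(2) by (simp add: is_povm_def)
    ultimately show ?thesis unfolding psd_def by (metis diff_ge_0_iff_ge)
  qed

  define H where "H = (\<lambda>i k. (if i = k then 1 else 0) - cinner (u i) (u k))"
  have "\<exists>c. \<forall>i\<in>{1..l}. \<forall>k\<in>{1..l}. (\<Sum>j\<in>{1..l}. cnj (c i j) * c k j) = H i k"
  proof (rule gram_factorization)
    show "H k i = cnj (H i k)" for i k
      by (simp add: H_def cnj_cinner)
    \<comment> \<open>The form of \<open>H\<close> at \<open>x\<close> is the squared norm of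
      \<open>x\<close> minus that of the combination of the \<open>u i\<close> with coefficients
      \<open>x\<close>.\<close>
    show "0 \<le> Re (\<Sum>i\<in>{1..l}. \<Sum>k\<in>{1..l}. cnj (x i) * H i k * x k)" for x
    proof -
      have "cinner (\<Sum>i\<in>{1..l}. x i *s u i) (\<Sum>i\<in>{1..l}. x i *s u i)
          = (\<Sum>i\<in>{1..l}. \<Sum>k\<in>{1..l}. cnj (x i) * cinner (u i) (u k) * x k)"
        unfolding cinner_sum_left unfolding cinner_sum_right cinner_scale_left cinner_scale_right
        by (simp add: mult_ac)
      moreover have "(\<Sum>i\<in>{1..l}. of_real ((cmod (x i))\<^sup>2))
          = (\<Sum>i\<in>{1..l}. \<Sum>k\<in>{1..l}. if i = k then cnj (x i) * x k else 0)"
        by (intro sum.cong refl) (simp add: complex_norm_square mult.commute del: of_real_power)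
      ultimately have "(\<Sum>i\<in>{1..l}. \<Sum>k\<in>{1..l}. cnj (x i) * H i k * x k)
          = (\<Sum>i\<in>{1..l}. of_real ((cmod (x i))\<^sup>2)) - of_real ((norm (\<Sum>i\<in>{1..l}. x i *s u i))\<^sup>2)"
        unfolding cinner_self[symmetric]
        by (simp only: sum_subtractf[symmetric]) (intro sum.cong refl, simp add: H_def algebra_simps)
      then show ?thesis
        using contraction_of_bessel[OF bessel, of x] by (simp del: of_real_power)
    qed
  qed simp
  then obtain c0 where c0: "\<And>i k. i \<in> {1..l} \<Longrightarrow> k \<in> {1..l} \<Longrightarrow>
      (\<Sum>j\<in>{1..l}. cnj (c0 i j) * c0 k j) = H i k"
    by blast

  define W where "W = cspan (\<psi> ` {1..l})"
  have subW: "vec.subspace W" by (simp add: W_def cspan_eq_span)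
  define D where "D = cdim (corth W)"
  have D: "D = vec.dim (corth W)"
    unfolding D_def by (rule cdim_eq_dim[OF subspace_corth])
  have "vec.dim W \<le> card (\<psi> ` {1..l})"
    unfolding W_def cspan_eq_span by (intro vec.dim_le_card) auto
  also have "\<dots> \<le> l"
    using card_image_le[of "{1..l}" \<psi>] by simp
  \<comment> \<open>With \<open>2 * l \<le> CARD('n)\<close> this leaves room for \<open>l\<close>
    coordinates in the complement. It also excludes \<open>D = 0\<close>, which would force the
    space to have dimension 0.\<close>
  finally have "CARD('n) \<le> l + D"
    using dim_corth_ge[OF subW] D by simp
  moreover have "CARD('n) > 0" by simp
  ultimately have lD: "l \<le> D" and D0: "D > 0"
    using assms(1) by linarith+

  obtain T where T: "corthonormal T" "finite T" "vec.span T = corth W" "card T = D"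
    using corthonormal_basis_exists[OF subspace_corth] D by metis
  obtain f where f: "bij_betw f {..<D} T"
    using ex_bij_betw_nat_finite[OF T(2)] T(4) by (auto simp: atLeast0LessThan)
  have ff: "cinner (f j) (f k) = (if j = k then 1 else 0)" if "j < D" "k < D" for j k
    using that f T(1) unfolding corthonormal_def bij_betw_def inj_on_def by auto
  have proj: "orth_proj (corth W) = (\<Sum>j<D. outer (f j))"
    using orth_proj_span[OF T(1,2)] sum.reindex_bij_betw[OF f, of outer] T(3) by simp
  have uf: "cinner (u i) (f j) = 0" "cinner (f j) (u i) = 0" if "i \<in> {1..l}" "j < D" for i j
  proof -
    have "f j \<in> corth W"
      using that f T(3) by (metis bij_betwE lessThan_iff vec.span_base)
    moreover have "u i \<in> W"
      unfolding W_def cspan_eq_span u_def using that by (intro vec.span_scale vec.span_base) auto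
    ultimately show "cinner (u i) (f j) = 0" by (simp add: corth_def)
    then show "cinner (f j) (u i) = 0" by (metis cnj_cinner complex_cnj_zero)
  qed

  \<comment> \<open>The coordinates are renumbered from 0 and padded with zeros up to
    \<open>D\<close>, one for each basis vector \<open>f j\<close>; this uses
    \<open>l \<le> D\<close>.\<close>
  define c where "c = (\<lambda>i j. if j < l then c0 i (Suc j) else 0)"
  have c: "(\<Sum>j<D. cnj (c i j) * c k j) = H i k" if "i \<in> {1..l}" "k \<in> {1..l}" for i k
  proof -
    have "(\<Sum>j<D. cnj (c i j) * c k j) = (\<Sum>j<l. cnj (c0 i (Suc j)) * c0 k (Suc j))"
      using lD by (intro sum.mono_neutral_cong_right) (auto simp: c_def)
    also have "\<dots> = (\<Sum>j\<in>{1..l}. cnj (c0 i j) * c0 k j)"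
      by (simp add: sum.atLeast1_atMost_eq)
    finally show ?thesis using c0[OF that] by simp
  qed

  \<comment> \<open>The vectors \<open>e (a, b) i\<close> for \<open>i = 1, \<dots>, l\<close> are orthonormal: the components \<open>c\<close> in the
    complement of \<open>W\<close> have Gram matrix \<open>1 - G\<close>, where \<open>G\<close> is that of the vectors \<open>u\<close>. Giving
    \<open>W\<close> and \<open>f 0, \<dots>, f (D - 1)\<close> distinct characters of the cyclic group of order \<open>D + 1\<close>, the
    average over \<open>b\<close> kills all cross terms, and the average over the shifts \<open>a\<close> makes the
    diagonal on the complement of \<open>W\<close> constant.\<close>
  define g where "g = (\<lambda>a i j. case j of 0 \<Rightarrow> u i | Suc m \<Rightarrow> c i ((m + a) mod D) *s f m)"
  define \<omega> where "\<omega> = (\<lambda>j. cis (2 * pi * real j / real (Suc D)))"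
  define e where "e = (\<lambda>(a, b) i. \<Sum>j<Suc D. \<omega> j ^ b *s g a i j)"
  have unit: "cnj (\<omega> j ^ b) * \<omega> j ^ b = 1" for j b
    by (simp add: \<omega>_def norm_power mult.commute[of "cnj _"] flip: complex_norm_square power_mult_distrib)
  have g_orth: "cinner (g a i j) (g a k m) = 0"
    if "i \<in> {1..l}" "k \<in> {1..l}" "j < Suc D" "m < Suc D" "j \<noteq> m" for a i j k m
    using that uf ff by (auto simp: g_def cinner_scale_left cinner_scale_right split: nat.splits)
  have e_orth: "cinner (e s i) (e s k) = (if i = k then 1 else 0)"
    if ik: "i \<in> {1..l}" "k \<in> {1..l}" for s i k
  proof -
    obtain a b where s: "s = (a, b)" by (cases s)
    have "cinner (e s i) (e s k)
        = (\<Sum>j<Suc D. \<Sum>m<Suc D. cnj (\<omega> j ^ b) * (\<omega> m ^ b * cinner (g a i j) (g a k m)))"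
      unfolding e_def s prod.case cinner_sum_left
      unfolding cinner_sum_right cinner_scale_left cinner_scale_right by (simp add: sum_distrib_left mult_ac del: sum.lessThan_Suc)
    \<comment> \<open>Distinct slots are orthogonal, and within one slot the phase cancels against
      its conjugate.\<close>
    also have "\<dots> = (\<Sum>j<Suc D. \<Sum>m<Suc D. if j = m then cinner (g a i j) (g a k m) else 0)"
    proof (intro sum.cong refl)
      fix j m assume "j \<in> {..<Suc D}" "m \<in> {..<Suc D}"
      then show "cnj (\<omega> j ^ b) * (\<omega> m ^ b * cinner (g a i j) (g a k m))
          = (if j = m then cinner (g a i j) (g a k m) else 0)"
        using g_orth[OF ik, of j m a] unit[of j b] by (auto simp flip: mult.assoc)
    qed
    also have "\<dots> = (\<Sum>j<Suc D. cinner (g a i j) (g a k j))"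
      by (intro sum.cong refl) (subst sum.delta', auto)
    also have "\<dots> = cinner (u i) (u k) + (\<Sum>j<D. cnj (c i ((j + a) mod D)) * c k ((j + a) mod D))"
      by (simp add: sum.lessThan_Suc_shift g_def cinner_scale_left cinner_scale_right ff mult.commute
          del: sum.lessThan_Suc)
    \<comment> \<open>The shift permutes the coordinates of both vectors alike, so it preserves
      their Gram matrix \<open>H\<close>, which complements that of the \<open>u i\<close> to the
      identity.\<close>
    also have "(\<Sum>j<D. cnj (c i ((j + a) mod D)) * c k ((j + a) mod D)) = H i k"
      using sum_shift_mod[of "\<lambda>j. cnj (c i j) * c k j" a D] c[OF ik] by (simp add: add.commute)
    finally show ?thesis by (simp add: H_def)
  qed

  define I where "I = {..<D} \<times> {..<Suc D}"
  have card_I: "card I = D * Suc D" by (simp add: I_def card_cartesian_product)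
  have avg: "(\<Sum>s\<in>I. (1 / real (card I)) *\<^sub>R outer (e s i)) = F i" if i: "i \<in> {1..l}" for i
  proof -
    \<comment> \<open>The diagonal entry of \<open>H\<close>: the total weight that outcome
      \<open>i\<close> places on the complement of \<open>W\<close>.\<close>
    have norm_c: "(\<Sum>j<D. (cmod (c i j))\<^sup>2) = 1 - A i"
    proof -
      have "complex_of_real (\<Sum>j<D. (cmod (c i j))\<^sup>2) = (\<Sum>j<D. cnj (c i j) * c i j)"
        unfolding of_real_sum complex_norm_square by (simp add: mult.commute)
      also have "\<dots> = of_real (1 - A i)"
        by (simp add: c[OF i i] H_def uu[OF i])
      finally show ?thesis by (simp only: of_real_eq_iff)
    qed
    have "(\<Sum>s\<in>I. outer (e s i)) = (\<Sum>a<D. \<Sum>b<Suc D. outer (e (a, b) i))"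
      unfolding I_def by (simp only: sum.cartesian_product case_prod_eta) (simp add: case_prod_unfold)
    also have "\<dots> = (\<Sum>a<D. real (Suc D) *\<^sub>R (\<Sum>j<Suc D. outer (g a i j)))"
      unfolding e_def \<omega>_def prod.case sum_outer_dft ..
    also have "\<dots> = real (Suc D) *\<^sub>R (\<Sum>a<D. outer (u i) + (\<Sum>j<D. (cmod (c i ((j + a) mod D)))\<^sup>2 *\<^sub>R outer (f j)))"
      by (simp add: scaleR_sum_right[symmetric] sum.lessThan_Suc_shift g_def outer_scale
          del: sum.lessThan_Suc)
    \<comment> \<open>As \<open>a\<close> runs over all shifts, each \<open>f j\<close> meets every
      coordinate of \<open>c i\<close> once and so receives the whole weight.\<close>
    also have "(\<Sum>a<D. outer (u i) + (\<Sum>j<D. (cmod (c i ((j + a) mod D)))\<^sup>2 *\<^sub>R outer (f j)))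
        = real D *\<^sub>R outer (u i) + (\<Sum>j<D. (\<Sum>a<D. (cmod (c i ((j + a) mod D)))\<^sup>2) *\<^sub>R outer (f j))"
      unfolding sum.distrib scaleR_sum_left
      by (subst (2) sum.swap) (simp only: sum_constant_scaleR card_lessThan)
    also have "\<dots> = real D *\<^sub>R outer (u i) + (1 - A i) *\<^sub>R orth_proj (corth W)"
      unfolding proj scaleR_sum_right using sum_shift_mod[of "\<lambda>j. (cmod (c i j))\<^sup>2"] norm_c by simp
    finally have "(\<Sum>s\<in>I. outer (e s i))
        = real (Suc D) *\<^sub>R (real D *\<^sub>R outer (u i) + (1 - A i) *\<^sub>R orth_proj (corth W))" .
    then have "(\<Sum>s\<in>I. (1 / real (card I)) *\<^sub>R outer (e s i))
        = ((1 / real (card I)) * real (Suc D)) *\<^sub>R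
          (real D *\<^sub>R outer (u i) + (1 - A i) *\<^sub>R orth_proj (corth W))"
      by (simp only: scaleR_sum_right[symmetric] scaleR_scaleR)
    \<comment> \<open>The phase sum used up the factor \<open>Suc D\<close>. The remaining
      \<open>1 / D\<close> compensates the \<open>D\<close> copies of \<open>outer (u i)\<close> and
      normalises the projector.\<close>
    also have "(1 / real (card I)) * real (Suc D) = 1 / real D"
      using D0 unfolding card_I of_nat_mult by (simp del: of_nat_Suc)
    also have "(1 / real D) *\<^sub>R (real D *\<^sub>R outer (u i) + (1 - A i) *\<^sub>R orth_proj (corth W)) = F i"
      using D0 assms(6) i outer_u[OF i] by (simp add: scaleR_add_right W_def D_def)
    finally show ?thesis .
  qed

  define P where "P = (\<lambda>s i. if i \<le> l then outer (e s i) else mat 1 - (\<Sum>k\<in>{1..l}. outer (e s k)))"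
  have P: "is_projective (l + 1) (P s)" for s
    unfolding P_def using e_orth by (rule projective_of_orthonormal)
  have I: "finite I" "I \<noteq> {}" using D0 by (auto simp: I_def)
  have F: "F i = (\<Sum>s\<in>I. (1 / real (card I)) *\<^sub>R P s i)" if "i \<in> {1..l + 1}" for i
  proof (cases "i \<le> l")
    case True
    then show ?thesis using that avg[of i] by (simp add: P_def)
  next
    case False
    then have i: "i = l + 1" using that by simp
    \<comment> \<open>The last effect is the complement of the others both in \<open>F\<close> and
      in every \<open>P s\<close>, so averaging carries over by linearity.\<close>
    have "(\<Sum>s\<in>I. (1 / real (card I)) *\<^sub>R P s i)
        = (\<Sum>s\<in>I. (1 / real (card I)) *\<^sub>R mat 1)
          - (\<Sum>s\<in>I. \<Sum>k\<in>{1..l}. (1 / real (card I)) *\<^sub>R outer (e s k))"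
      by (simp add: P_def i scaleR_diff_right sum_subtractf scaleR_sum_right del: sum_constant)
    also have "(\<Sum>s\<in>I. (1 / real (card I)) *\<^sub>R mat 1) = (mat 1 :: complex^'n^'n)"
      using I by (simp only: sum_constant_scaleR scaleR_scaleR) simp
    also have "(\<Sum>s\<in>I. \<Sum>k\<in>{1..l}. (1 / real (card I)) *\<^sub>R outer (e s k)) = (\<Sum>k\<in>{1..l}. F k)"
      by (subst sum.swap) (intro sum.cong refl avg)
    finally show ?thesis using assms(7) i by simp
  qed
  show ?thesis
    using uniform_average_projective[OF I P F] by blast
qed

end
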